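(* Consider the iterative rearrangement algorithm (described in the context) for maximizing the $m$-th gap-to-midgap ratio in two dimensions. At every iteration such that $\beta\neq\alpha$, the potential is weakly bang-bang. That is: if $(\alpha,\beta,V)$ is a maximizer of the optimization problem (SDP) of the context, solved in step 2 of an iteration, and $\beta\ne\alpha$, then there is at least one grid point $\ell\in\{1,\dots,n\}$ at which either $V_\ell=0$ or $V_\ell=V_+$.
   Context: Fix $m\in\mathbb N^+$, $V_+>0$, $\mu\ge1$, lattice parameters $(a,b)$ with $b>0$, $a\in[0,1/2]$, $a^2+b^2\ge1$, the matrix $B=\begin{pmatrix}\frac1{\sqrt b}&\frac a{\sqrt b}\\0&\sqrt b\end{pmatrix}$, and finitely many quasi-momenta $k_1,\dots,k_q\in\mathbb R^2$ in the Brillouin zone of the lattice generated by the columns of $B$. Take a uniform square periodic grid with $n$ points and spacing $h$ on the torus $\mathbb R^2/\mathbb Z^2$. For $k\in\mathbb R^2$ put $N=(B^tB)^{-1}$, $k_p=B^{-1}k$, and let $L_{a,b}(k)\in\mathbb C^{n\times n}$ be the Hermitian matrix of the nine-point periodic finite-difference operator with stencil (columns: $x_1-h,x_1,x_1+h$ from left to right; rows: $x_2+h,x_2,x_2-h$ from top to bottom) $$\begin{bmatrix}\frac{N_{21}+N_{12}}{4h^2}&-\frac{N_{22}}{h^2}-\frac ih k_{p,2}&-\frac{N_{21}+N_{12}}{4h^2}\\-\frac{N_{11}}{h^2}+\frac ihk_{p,1}&2\frac{N_{11}+N_{22}}{h^2}+k^tk&-\frac{N_{11}}{h^2}-\frac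 ihk_{p,1}\\-\frac{N_{21}+N_{12}}{4h^2}&-\frac{N_{22}}{h^2}+\frac ihk_{p,2}&\frac{N_{21}+N_{12}}{4h^2}\end{bmatrix}.$$ The algorithm starts from some $V\in[0,V_+]^n$ and repeats the following iteration. Step 1: for the current $V$ and each $j\in\{1,\dots,q\}$, compute orthonormal eigenvectors $u_1(k_j),\dots,u_{m+\mu}(k_j)\in\mathbb C^n$ of $L_{a,b}(k_j)+\mathrm{diag}(V)$ for its $m+\mu$ smallest eigenvalues in increasing order, and set $U_{\alpha,j}=[u_1(k_j)|\cdots|u_m(k_j)]$, $U_{\beta,j}=[u_{m+1}(k_j)|\cdots|u_{m+\mu}(k_j)]$. Step 2: replace $V$ by the $V$-component of a solution of (SDP): maximize $\dfrac{\beta-\alpha}{(\alpha+\beta)/2}$ over $\alpha,\beta>0$ and $V\in\mathbb R^n$ subject to $$U_{\alpha,j}^*\left[L_{a,b}(k_j)+\mathrm{diag}(V)-\alpha\,\mathrm{Id}\right]U_{\alpha,j}\preceq0,\qquad U_{\beta,j}^*\left[L_{a,b}(k_j)+\mathrm{diag}(V)-\beta\,\mathrm{Id}\right]U_{\beta,j}\succeq0\quad(j=1,\dots,q),$$ $$0\le V_\ell\le V_+\quad(\ell=1,\dots,n).$$ A vector $V\in[0,V_+]^n$ is called weakly bang-bang if some component $V_\ell$ equals $0$ or $V_+$. The potential "at an iteration" is the one produced by step 2. *)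

theory Defs
  imports Complex_Main "Jordan_Normal_Form.Schur_Decomposition"
begin

section \<open>Lattice and Brillouin zone\<close>

definition lattice_matrix :: "real \<Rightarrow> real \<Rightarrow> real mat" where
  "lattice_matrix a b =
     mat_of_rows_list 2 [[1 / sqrt b, a / sqrt b],
                         [0,          sqrt b]]"

abbreviation lattice_matrix_inv :: "real \<Rightarrow> real \<Rightarrow> real mat" where
  "lattice_matrix_inv a b \<equiv> the (mat_inverse (lattice_matrix a b))"

lemma lattice_matrix_inv:
  assumes "b > 0"
  shows "lattice_matrix_inv a b \<in> carrier_mat 2 2"
    "lattice_matrix a b * lattice_matrix_inv a b = 1\<^sub>m 2"
    "lattice_matrix_inv a b * lattice_matrix a b = 1\<^sub>m 2"
proof -
  have B: "lattice_matrix a b \<in> carrier_mat 2 2"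
    by (auto simp: lattice_matrix_def mat_of_rows_list_def)
  have "upper_triangular (lattice_matrix a b)"
    by (auto simp: upper_triangular_def lattice_matrix_def mat_of_rows_list_def less_Suc_eq)
  then have "det (lattice_matrix a b) = prod_list (diag_mat (lattice_matrix a b))"
    using B by (rule det_upper_triangular)
  also have "\<dots> \<noteq> 0"
    using assms by (simp add: diag_mat_def lattice_matrix_def mat_of_rows_list_def)
  finally have "det (lattice_matrix a b) \<noteq> 0" .
  then have "lattice_matrix a b \<in> Units (ring_mat TYPE(real) 2 ())"
    using B by (simp add: det_non_zero_imp_unit)
  then obtain C where C: "mat_inverse (lattice_matrix a b) = Some C"
    using mat_inverse(1)[OF B, where b = "()"] by (cases "mat_inverse (lattice_matrix a b)") auto
  from mat_inverse(2)[OF B C] C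
  show "lattice_matrix_inv a b \<in> carrier_mat 2 2"
    "lattice_matrix a b * lattice_matrix_inv a b = 1\<^sub>m 2"
    "lattice_matrix_inv a b * lattice_matrix a b = 1\<^sub>m 2"
    by auto
qed

definition lattice :: "real \<Rightarrow> real \<Rightarrow> real vec set" where
  "lattice a b = {lattice_matrix a b *\<^sub>v z | z. z \<in> carrier_vec 2 \<and> z $ 0 \<in> \<int> \<and> z $ 1 \<in> \<int>}"

text \<open>
  The reciprocal lattice carries the factor \<open>2 * pi\<close>, as fits Bloch waves
  \<open>exp (\<i> (k \<bullet> x))\<close>; the Brillouin zone is the closed Voronoi cell of its origin.
\<close>

definition dual_lattice :: "real \<Rightarrow> real \<Rightarrow> real vec set" where
  "dual_lattice a b = {G \<in> carrier_vec 2. \<forall>x \<in> lattice a b. (G \<bullet> x) / (2 * pi) \<in> \<int>}"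

definition brillouin_zone :: "real \<Rightarrow> real \<Rightarrow> real vec set" where
  "brillouin_zone a b =
     {k \<in> carrier_vec 2. \<forall>G \<in> dual_lattice a b. k \<bullet> k \<le> (k - G) \<bullet> (k - G)}"

section \<open>The finite-difference operator\<close>

text \<open>
  Matrix and vector entries count from 0, so \<open>N $$ (0,0)\<close> is the mathematical \<open>N\<^sub>1\<^sub>1\<close>.
  The weight given to the neighbour at \<open>(x\<^sub>1 + d\<^sub>1 h, x\<^sub>2 + d\<^sub>2 h)\<close>, for
  \<open>d\<^sub>1, d\<^sub>2 \<in> {-1,0,1}\<close>, is read off a table whose rows are \<open>d\<^sub>2 = 1, 0, -1\<close> and whose
  columns are \<open>d\<^sub>1 = -1, 0, 1\<close>.
\<close>

definition stencil :: "real \<Rightarrow> real \<Rightarrow> real \<Rightarrow> real vec \<Rightarrow> int \<Rightarrow> int \<Rightarrow> complex" where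
  "stencil a b h k d1 d2 =
    (let B = lattice_matrix a b;
         N = the (mat_inverse (B\<^sup>T * B));
         kp = lattice_matrix_inv a b *\<^sub>v k;
         X = complex_of_real ((N $$ (1,0) + N $$ (0,1)) / (4 * h\<^sup>2));
         N1 = complex_of_real (N $$ (0,0) / h\<^sup>2);
         N2 = complex_of_real (N $$ (1,1) / h\<^sup>2);
         K1 = \<i> / complex_of_real h * complex_of_real (kp $ 0);
         K2 = \<i> / complex_of_real h * complex_of_real (kp $ 1)
     in [[X,         - N2 - K2,                                  - X],
         [- N1 + K1, 2 * (N1 + N2) + complex_of_real (k \<bullet> k),   - N1 - K1],
         [- X,       - N2 + K2,                                  X]]
        ! nat (1 - d2) ! nat (d1 + 1))"

text \<open>
  The grid has \<open>p\<close> points per direction, hence \<open>n = p\<^sup>2\<close> points and spacing \<open>h = 1 / p\<close>.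
  Point \<open>l < p\<^sup>2\<close> has coordinates \<open>(h * (l mod p), h * (l div p))\<close>.
\<close>

definition neighbour :: "nat \<Rightarrow> nat \<Rightarrow> int \<Rightarrow> int \<Rightarrow> nat" where
  "neighbour p l d1 d2 =
     nat ((int (l mod p) + d1) mod int p) + p * nat ((int (l div p) + d2) mod int p)"

text \<open>The weights are summed because neighbours coincide on grids with \<open>p < 3\<close>.\<close>

definition fd_matrix :: "nat \<Rightarrow> real \<Rightarrow> real \<Rightarrow> real vec \<Rightarrow> complex mat" where
  "fd_matrix p a b k = mat (p\<^sup>2) (p\<^sup>2) (\<lambda>(r, c).
     \<Sum>d1\<in>{-1..1}. \<Sum>d2\<in>{-1..1}.
       if neighbour p r d1 d2 = c then stencil a b (1 / real p) k d1 d2 else 0)"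

lemma neighbour_less:
  assumes "p > 0" shows "neighbour p l d1 d2 < p\<^sup>2"
proof -
  have x: "nat ((int (l mod p) + d1) mod int p) < p"
    and y: "nat ((int (l div p) + d2) mod int p) < p"
    using assms by (simp_all add: nat_less_iff)
  then have "nat ((int (l mod p) + d1) mod int p) + p * nat ((int (l div p) + d2) mod int p)
      < p * Suc (nat ((int (l div p) + d2) mod int p))"
    by simp
  also have "\<dots> \<le> p * p"
    using y by (intro mult_le_mono2) simp
  finally show ?thesis
    by (simp add: neighbour_def power2_eq_square)
qed

lemma neighbour_inverse:
  assumes "r < p\<^sup>2"
  shows "neighbour p (neighbour p r d1 d2) (- d1) (- d2) = r"
proof -
  have p: "p > 0" using assms by (cases p) auto
  have rdiv: "r div p < p"
    using assms by (simp add: less_mult_imp_div_less power2_eq_square)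
  have x: "nat ((int (r mod p) + d1) mod int p) < p"
    using p by (simp add: nat_less_iff)
  have m: "neighbour p r d1 d2 mod p = nat ((int (r mod p) + d1) mod int p)"
    and d: "neighbour p r d1 d2 div p = nat ((int (r div p) + d2) mod int p)"
    using x p by (simp_all add: neighbour_def)
  have u: "((int (r mod p) + d1) mod int p - d1) mod int p = int (r mod p)"
    by (metis add_diff_cancel_right' mod_diff_left_eq mod_mod_trivial of_nat_mod)
  have v: "((int (r div p) + d2) mod int p - d2) mod int p = int (r div p)"
    using rdiv by (metis add_diff_cancel_right' mod_diff_left_eq mod_less of_nat_mod)
  show ?thesis
    unfolding neighbour_def[of p "neighbour p r d1 d2"] m d
    using p u v by simp
qed

lemma neighbour_symmetric:
  assumes "r < p\<^sup>2" "c < p\<^sup>2"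
  shows "neighbour p c d1 d2 = r \<longleftrightarrow> neighbour p r (- d1) (- d2) = c"
  using neighbour_inverse[OF assms(1), of "- d1" "- d2"] neighbour_inverse[OF assms(2), of d1 d2]
  by auto

lemma fd_matrix_hermitian:
  assumes "r < p\<^sup>2" "c < p\<^sup>2"
  shows "fd_matrix p a b k $$ (c, r) = cnj (fd_matrix p a b k $$ (r, c))"
proof -
  have i: "{-1..1::int} = {-1, 0, 1}" by auto
  have st: "cnj (stencil a b h k d1 d2) = stencil a b h k (- d1) (- d2)"
    if "d1 \<in> {-1, 0, 1}" "d2 \<in> {-1, 0, 1}" for h d1 d2
    using that by (auto simp: stencil_def Let_def numeral_2_eq_2)
  show ?thesis
    using assms
    by (simp add: fd_matrix_def i if_distrib[of cnj] st neighbour_symmetric[OF assms] 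
        cong: if_cong) 
qed

section \<open>Step 1: eigenvectors\<close>

text \<open>\<open>es\<close> lists the eigenvalues of \<open>A\<close> in increasing order, with multiplicity.\<close>

definition ordered_eigenvalues :: "complex mat \<Rightarrow> real list \<Rightarrow> bool" where
  "ordered_eigenvalues A es \<longleftrightarrow>
     sorted es \<and> char_poly A = (\<Prod>e\<leftarrow>es. [:- complex_of_real e, 1:])"

text \<open>\<open>u 1, \<dots>, u r\<close> are orthonormal eigenvectors for the \<open>r\<close> smallest eigenvalues of \<open>A\<close>.\<close>

definition lowest_eigenvectors :: "complex mat \<Rightarrow> nat \<Rightarrow> (nat \<Rightarrow> complex vec) \<Rightarrow> bool" where
  "lowest_eigenvectors A r u \<longleftrightarrow>
     r \<le> dim_row A \<and>
     (\<forall>i\<in>{1..r}. \<forall>j\<in>{1..r}. u i \<bullet>c u j = (if i = j then 1 else 0)) \<and>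
     (\<exists>es. ordered_eigenvalues A es \<and>
        (\<forall>i\<in>{1..r}. eigenvector A (u i) (complex_of_real (es ! (i - 1)))))"

definition potential_matrix :: "nat \<Rightarrow> real vec \<Rightarrow> complex mat" where
  "potential_matrix n V = mat_diag n (\<lambda>l. complex_of_real (V $ l))"

definition step1 ::
  "nat \<Rightarrow> nat \<Rightarrow> nat \<Rightarrow> nat \<Rightarrow> (nat \<Rightarrow> complex mat) \<Rightarrow> real vec \<Rightarrow> (nat \<Rightarrow> nat \<Rightarrow> complex vec) \<Rightarrow> bool"
where
  "step1 n m \<mu> q L V u \<longleftrightarrow>
     (\<forall>j\<in>{1..q}. lowest_eigenvectors (L j + potential_matrix n V) (m + \<mu>) (u j))"

definition U_alpha :: "nat \<Rightarrow> nat \<Rightarrow> (nat \<Rightarrow> complex vec) \<Rightarrow> complex mat" where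
  "U_alpha n m u = mat_of_cols n (map u [1..<m + 1])"

definition U_beta :: "nat \<Rightarrow> nat \<Rightarrow> nat \<Rightarrow> (nat \<Rightarrow> complex vec) \<Rightarrow> complex mat" where
  "U_beta n m \<mu> u = mat_of_cols n (map u [m + 1..<m + \<mu> + 1])"

section \<open>Step 2: the semidefinite program\<close>

text \<open>
  The order on \<open>complex\<close> is the one of \<open>Complex_Order\<close>: \<open>0 \<le> z\<close> says that \<open>z\<close> is real and
  nonnegative, so positive semidefiniteness here includes being Hermitian.
\<close>

definition psd :: "complex mat \<Rightarrow> bool" where
  "psd A \<longleftrightarrow> square_mat A \<and> (\<forall>v \<in> carrier_vec (dim_row A). 0 \<le> (A *\<^sub>v v) \<bullet>c v)"

definition admissible_potentials :: "nat \<Rightarrow> real \<Rightarrow> real vec set" where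
  "admissible_potentials n Vplus = {V \<in> carrier_vec n. \<forall>l<n. 0 \<le> V $ l \<and> V $ l \<le> Vplus}"

definition compression ::
  "nat \<Rightarrow> complex mat \<Rightarrow> complex mat \<Rightarrow> real vec \<Rightarrow> real \<Rightarrow> complex mat" where
  "compression n U A V t =
     mat_adjoint U * (A + potential_matrix n V - complex_of_real t \<cdot>\<^sub>m 1\<^sub>m n) * U"

definition sdp_feasible ::
  "nat \<Rightarrow> nat \<Rightarrow> nat \<Rightarrow> real \<Rightarrow> nat \<Rightarrow> (nat \<Rightarrow> complex mat) \<Rightarrow> (nat \<Rightarrow> nat \<Rightarrow> complex vec) \<Rightarrow>
   real \<times> real \<times> real vec \<Rightarrow> bool"
where
  "sdp_feasible n m \<mu> Vplus q L u = (\<lambda>(\<alpha>, \<beta>, V).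
     \<alpha> > 0 \<and> \<beta> > 0 \<and> V \<in> admissible_potentials n Vplus \<and>
     (\<forall>j\<in>{1..q}. psd (- compression n (U_alpha n m (u j)) (L j) V \<alpha>) \<and>
                 psd (compression n (U_beta n m \<mu> (u j)) (L j) V \<beta>)))"

definition sdp_objective :: "real \<times> real \<times> real vec \<Rightarrow> real" where
  "sdp_objective = (\<lambda>(\<alpha>, \<beta>, V). (\<beta> - \<alpha>) / ((\<alpha> + \<beta>) / 2))"

definition sdp_maximizer ::
  "nat \<Rightarrow> nat \<Rightarrow> nat \<Rightarrow> real \<Rightarrow> nat \<Rightarrow> (nat \<Rightarrow> complex mat) \<Rightarrow> (nat \<Rightarrow> nat \<Rightarrow> complex vec) \<Rightarrow>
   real \<times> real \<times> real vec \<Rightarrow> bool"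
where
  "sdp_maximizer n m \<mu> Vplus q L u x \<longleftrightarrow>
     is_arg_max sdp_objective (sdp_feasible n m \<mu> Vplus q L u) x"

section \<open>The algorithm\<close>

text \<open>
  The potentials that some run of the algorithm can hold after finitely many iterations. Neither
  the eigenvectors in step 1 nor the maximizer in step 2 is unique; every choice is allowed.
\<close>

inductive algorithm_potential ::
  "nat \<Rightarrow> nat \<Rightarrow> nat \<Rightarrow> real \<Rightarrow> nat \<Rightarrow> (nat \<Rightarrow> complex mat) \<Rightarrow> real vec \<Rightarrow> bool"
  for n m \<mu> :: nat and Vplus :: real and q :: nat and L :: "nat \<Rightarrow> complex mat"
where
  start: "V \<in> admissible_potentials n Vplus \<Longrightarrow> algorithm_potential n m \<mu> Vplus q L V"
| iterate: "algorithm_potential n m \<mu> Vplus q L V \<Longrightarrow> step1 n m \<mu> q L V u \<Longrightarrow>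
    sdp_maximizer n m \<mu> Vplus q L u (\<alpha>, \<beta>, V') \<Longrightarrow> algorithm_potential n m \<mu> Vplus q L V'"

definition weakly_bang_bang :: "nat \<Rightarrow> real \<Rightarrow> real vec \<Rightarrow> bool" where
  "weakly_bang_bang n Vplus V \<longleftrightarrow>
     V \<in> admissible_potentials n Vplus \<and> (\<exists>l<n. V $ l = 0 \<or> V $ l = Vplus)"

end

(* Adding a constant s to the potential and to both \<alpha> and \<beta> leaves the semidefinite constraints
   unchanged, keeps \<beta> - \<alpha> and moves the midgap by s. If the potential stays strictly between its
   bounds, a small s of either sign is allowed, and the sign opposite to that of \<beta> - \<alpha> increases
   the objective. *)
theory Submission
  imports Defs
begin

text \<open>The shift adds \<open>s\<close> times the identity to the potential matrix and subtracts
  it again through \<open>t + s\<close>, so the matrix between the two factors \<open>U\<close> is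
  the same.\<close>

lemma compression_shift:
  "compression n U A (vec n (\<lambda>l. V $ l + s)) (t + s) = compression n U A V t"
proof -
  have "A + potential_matrix n (vec n (\<lambda>l. V $ l + s)) - complex_of_real (t + s) \<cdot>\<^sub>m 1\<^sub>m n =
      A + potential_matrix n V - complex_of_real t \<cdot>\<^sub>m 1\<^sub>m n"
    by (rule eq_matI) (auto simp: potential_matrix_def mat_diag_def)
  then show ?thesis
    by (simp add: compression_def)
qed

lemma sdp_feasible_shift:
  assumes "sdp_feasible n m \<mu> Vplus q L u (\<alpha>, \<beta>, V)"
    and "\<alpha> + s > 0" "\<beta> + s > 0" "\<And>l. l < n \<Longrightarrow> 0 \<le> V $ l + s \<and> V $ l + s \<le> Vplus"
  shows "sdp_feasible n m \<mu> Vplus q L u (\<alpha> + s, \<beta> + s, vec n (\<lambda>l. V $ l + s))"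
  using assms by (simp add: sdp_feasible_def compression_shift admissible_potentials_def)

text \<open>The gap is fixed and both midgaps are positive: a smaller midgap raises a positive
  ratio, a larger one moves a negative ratio towards 0. The sign condition on \<open>s\<close>
  covers both cases.\<close>

lemma sdp_objective_shift_less:
  assumes "\<alpha> + \<beta> > 0" "\<alpha> + s + (\<beta> + s) > 0" "(\<beta> - \<alpha>) * s < 0"
  shows "sdp_objective (\<alpha>, \<beta>, V) < sdp_objective (\<alpha> + s, \<beta> + s, V')"
proof -
  \<comment> \<open>This is the claim cross-multiplied; the two sides differ by
    \<open>2 * s * (\<beta> - \<alpha>)\<close>.\<close>
  have "(\<beta> - \<alpha>) * (\<alpha> + s + (\<beta> + s)) < (\<beta> - \<alpha>) * (\<alpha> + \<beta>)"
    using assms(3) by (simp add: algebra_simps)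
  then have "(\<beta> - \<alpha>) / (\<alpha> + \<beta>) < (\<beta> - \<alpha>) / (\<alpha> + s + (\<beta> + s))"
    using assms(1,2) by (simp add: divide_less_eq less_divide_eq)
  then have "2 * ((\<beta> - \<alpha>) / (\<alpha> + \<beta>)) < 2 * ((\<beta> - \<alpha>) / (\<alpha> + s + (\<beta> + s)))"
    by linarith
  then show ?thesis
    by (simp add: sdp_objective_def mult.commute)
qed

lemma sdp_maximizer_weakly_bang_bang:
  assumes max: "sdp_maximizer n m \<mu> Vplus q L u (\<alpha>, \<beta>, V)" and "\<beta> \<noteq> \<alpha>"
  shows "weakly_bang_bang n Vplus V"
proof (rule ccontr)
  assume not_wbb: "\<not> weakly_bang_bang n Vplus V"
  have feasible: "sdp_feasible n m \<mu> Vplus q L u (\<alpha>, \<beta>, V)"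
    using max by (simp add: sdp_maximizer_def is_arg_max_def)
  then have pos: "\<alpha> > 0" "\<beta> > 0" and adm: "V \<in> admissible_potentials n Vplus"
    by (simp_all add: sdp_feasible_def)
  have interior: "0 < V $ l" "V $ l < Vplus" if "l < n" for l
    using adm not_wbb that by (force simp: weakly_bang_bang_def admissible_potentials_def)+
  \<comment> \<open>\<open>S\<close> collects the slacks of all scalar constraints: positivity of
    \<alpha> and \<beta>, and both bounds at each grid point.\<close>
  define S where "S = {\<alpha>, \<beta>} \<union> (\<lambda>l. V $ l) ` {..<n} \<union> (\<lambda>l. Vplus - V $ l) ` {..<n}"
  have S: "finite S" "S \<noteq> {}" "\<And>x. x \<in> S \<Longrightarrow> x > 0"
    using pos interior by (auto simp: S_def)
  \<comment> \<open>Halving keeps \<open>d\<close> strictly below every slack, as the strict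
    constraints on \<alpha> and \<beta> demand.\<close>
  define d where "d = Min S / 2"
  have "Min S > 0"
    using S by simp
  then have "0 < d"
    by (simp add: d_def)
  have less: "d < x" if "x \<in> S" for x
    using Min_le[OF S(1) that] \<open>Min S > 0\<close> by (simp add: d_def)
  define s where "s = (if \<alpha> < \<beta> then - d else d)"
  have s: "\<bar>s\<bar> = d" "(\<beta> - \<alpha>) * s < 0"
    using \<open>0 < d\<close> \<open>\<beta> \<noteq> \<alpha>\<close> by (auto simp: s_def mult_less_0_iff)
  have ab: "\<alpha> + s > 0" "\<beta> + s > 0"
    using less[of \<alpha>] less[of \<beta>] s(1) by (auto simp: S_def)
  have "0 \<le> V $ l + s \<and> V $ l + s \<le> Vplus" if "l < n" for l
    using less[of "V $ l"] less[of "Vplus - V $ l"] s(1) that by (auto simp: S_def)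
  with feasible ab
  have "sdp_feasible n m \<mu> Vplus q L u (\<alpha> + s, \<beta> + s, vec n (\<lambda>l. V $ l + s))"
    by (rule sdp_feasible_shift)
  moreover have "sdp_objective (\<alpha>, \<beta>, V) < sdp_objective (\<alpha> + s, \<beta> + s, vec n (\<lambda>l. V $ l + s))"
    using pos ab s(2) by (intro sdp_objective_shift_less) auto
  ultimately show False
    using max by (auto simp: sdp_maximizer_def is_arg_max_def)
qed

text \<open>\<open>V\<close> may be any potential reachable by a run and \<open>u\<close> any
  admissible choice of eigenvectors, so every iteration is covered.\<close>

theorem proposition4p1:
  fixes p n m \<mu> q :: nat and Vplus a b \<alpha> \<beta> :: real
    and k :: "nat \<Rightarrow> real vec" and L :: "nat \<Rightarrow> complex mat"
    and V V' :: "real vec" and u :: "nat \<Rightarrow> nat \<Rightarrow> complex vec"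
  assumes "p \<ge> 1" and "n = p\<^sup>2" and "m \<ge> 1" and "\<mu> \<ge> 1" and "Vplus > 0"
    and "b > 0" and "0 \<le> a" and "a \<le> 1 / 2" and "a\<^sup>2 + b\<^sup>2 \<ge> 1"
    and "\<forall>j\<in>{1..q}. k j \<in> brillouin_zone a b"
    and "\<forall>j\<in>{1..q}. L j = fd_matrix p a b (k j)"
    and "algorithm_potential n m \<mu> Vplus q L V"
    and "step1 n m \<mu> q L V u"
    and "sdp_maximizer n m \<mu> Vplus q L u (\<alpha>, \<beta>, V')"
    and "\<beta> \<noteq> \<alpha>"
  shows "weakly_bang_bang n Vplus V'"
  using assms by (blast intro: sdp_maximizer_weakly_bang_bang)

end
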